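(* Let $\mathbb{D}$ be a domain satisfying path-connectedness and leaf symmetry. Then $\mathbb{D}$ is a non-dictatorial domain if and only if it satisfies the unique seconds property.
   Context: Let $A$ be a finite set of alternatives with $|A|=m\ge 3$. A preference is a linear order (strict) $P_i$ on $A$; $r_k(P_i)$ is its $k$-th ranked alternative and $r_1(P_i)$ its peak. A domain $\mathbb{D}$ is a set of preferences on $A$; $\mathbb{D}^a=\{P_i\in\mathbb{D}: r_1(P_i)=a\}$. Voters are $N=\{1,\dots,n\}$, $n\ge 2$. A social choice function (SCF) is a map $f:\mathbb{D}^n\to A$. It is unanimous if $f(P)=a$ whenever all voters' peaks at $P$ equal $a$; a unanimous SCF is called a rule. It is strategy-proof if for all $i\in N$, $P_i,P_i'\in\mathbb{D}$, $P_{-i}\in\mathbb{D}^{n-1}$, either $f(P_i,P_{-i})=f(P_i',P_{-i})$ or $f(P_i,P_{-i})\mathrel{P_i}f(P_i',P_{-i})$. It is a dictatorship if there is $i\in N$ with $f(P)=r_1(P_i)$ for all $P\in\mathbb{D}^n$. A domain is dictatorial if for every $n\ge 2$ every strategy-proof rule $f:\mathbb{D}^n\to A$ is a dictatorship; otherwise (i.e. if for some $n\ge 2$ it admits a non-dictatorial strategy-proof rule) it is non-dictatorial. Two alternatives $a\neq b$ are adjacent in $\mathbb{D}$, written $a\sim b$, if there are $P_i,P_i'\in\mathbb{D}$ with $r_1(P_i)=r_2(P_i')=a$, $r_1(P_i')=r_2(P_i)=b$ and $r_k(P_i)=r_k(P_i')$ for all $k\in\{3,\dots,m\}$. The adjacency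 graph $G_\sim^A$ is the undirected graph with vertex set $A$ whose edges are the adjacent pairs. $\mathbb{D}$ is path-connected if $G_\sim^A$ is connected. $\mathcal{N}_\sim^A(x)$ is the set of neighbors of $x$ in $G_\sim^A$, and $\mathrm{Leaf}(G_\sim^A)=\{x: |\mathcal{N}_\sim^A(x)|=1\}$. Let $\mathcal{S}(\mathbb{D}^a)=\{r_2(P_i): P_i\in\mathbb{D}^a\}$. $\mathbb{D}$ satisfies leaf symmetry if for each $x\in\mathrm{Leaf}(G_\sim^A)$ with $|\mathcal{S}(\mathbb{D}^x)|>1$ there is $z\in\mathcal{S}(\mathbb{D}^x)$ with $z\notin\mathcal{N}_\sim^A(x)$ and $x\in\mathcal{S}(\mathbb{D}^z)$. $\mathbb{D}$ satisfies the unique seconds property if there is $x\in A$ with $|\mathcal{S}(\mathbb{D}^x)|=1$. *)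

theory Defs
  imports Main "HOL-Library.FuncSet"
begin

(* "(x, y) \<in> P" reads "x is strictly preferred to y according to P". The library predicate
   strict_linear_order_on does not bound the field of the relation, hence the extra conjunct. *)
definition preference :: "'a set \<Rightarrow> 'a rel \<Rightarrow> bool" where
  "preference A P \<longleftrightarrow> P \<subseteq> A \<times> A \<and> strict_linear_order_on A P"

definition is_domain :: "'a set \<Rightarrow> 'a rel set \<Rightarrow> bool" where
  "is_domain A D \<longleftrightarrow> (\<forall>P\<in>D. preference A P)"

(* The k-th ranked alternative, k \<in> {1..card A}: exactly k - 1 alternatives are preferred to it. *)
definition ranked :: "'a set \<Rightarrow> nat \<Rightarrow> 'a rel \<Rightarrow> 'a" where
  "ranked A k P = (THE x. x \<in> A \<and> card {y \<in> A. (y, x) \<in> P} + 1 = k)"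

abbreviation peak :: "'a set \<Rightarrow> 'a rel \<Rightarrow> 'a" where
  "peak A P \<equiv> ranked A 1 P"

definition peak_domain :: "'a set \<Rightarrow> 'a rel set \<Rightarrow> 'a \<Rightarrow> 'a rel set" where
  "peak_domain A D a = {P \<in> D. peak A P = a}"

definition seconds :: "'a set \<Rightarrow> 'a rel set \<Rightarrow> 'a \<Rightarrow> 'a set" where
  "seconds A D a = ranked A 2 ` peak_domain A D a"

(* Profiles are the extensional functions on the set of voters; the values of an SCF outside
   of this set are irrelevant and are not constrained by any of the properties below. *)
definition profiles :: "nat \<Rightarrow> 'a rel set \<Rightarrow> (nat \<Rightarrow> 'a rel) set" where
  "profiles n D = ({1..n} \<rightarrow>\<^sub>E D)"

definition scf :: "'a set \<Rightarrow> 'a rel set \<Rightarrow> nat \<Rightarrow> ((nat \<Rightarrow> 'a rel) \<Rightarrow> 'a) \<Rightarrow> bool" where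
  "scf A D n f \<longleftrightarrow> f \<in> profiles n D \<rightarrow> A"

definition unanimous :: "'a set \<Rightarrow> 'a rel set \<Rightarrow> nat \<Rightarrow> ((nat \<Rightarrow> 'a rel) \<Rightarrow> 'a) \<Rightarrow> bool" where
  "unanimous A D n f \<longleftrightarrow>
     (\<forall>P\<in>profiles n D. \<forall>a\<in>A. (\<forall>i\<in>{1..n}. peak A (P i) = a) \<longrightarrow> f P = a)"

definition rule :: "'a set \<Rightarrow> 'a rel set \<Rightarrow> nat \<Rightarrow> ((nat \<Rightarrow> 'a rel) \<Rightarrow> 'a) \<Rightarrow> bool" where
  "rule A D n f \<longleftrightarrow> scf A D n f \<and> unanimous A D n f"

definition strategy_proof :: "'a rel set \<Rightarrow> nat \<Rightarrow> ((nat \<Rightarrow> 'a rel) \<Rightarrow> 'a) \<Rightarrow> bool" where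
  "strategy_proof D n f \<longleftrightarrow>
     (\<forall>i\<in>{1..n}. \<forall>P\<in>profiles n D. \<forall>P'\<in>D.
        f P = f (P(i := P')) \<or> (f P, f (P(i := P'))) \<in> P i)"

definition dictatorship :: "'a set \<Rightarrow> 'a rel set \<Rightarrow> nat \<Rightarrow> ((nat \<Rightarrow> 'a rel) \<Rightarrow> 'a) \<Rightarrow> bool" where
  "dictatorship A D n f \<longleftrightarrow> (\<exists>i\<in>{1..n}. \<forall>P\<in>profiles n D. f P = peak A (P i))"

definition dictatorial_domain :: "'a set \<Rightarrow> 'a rel set \<Rightarrow> bool" where
  "dictatorial_domain A D \<longleftrightarrow>
     (\<forall>n\<ge>2. \<forall>f. rule A D n f \<and> strategy_proof D n f \<longrightarrow> dictatorship A D n f)"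

definition non_dictatorial_domain :: "'a set \<Rightarrow> 'a rel set \<Rightarrow> bool" where
  "non_dictatorial_domain A D \<longleftrightarrow> \<not> dictatorial_domain A D"

definition adjacent :: "'a set \<Rightarrow> 'a rel set \<Rightarrow> 'a \<Rightarrow> 'a \<Rightarrow> bool" where
  "adjacent A D a b \<longleftrightarrow> a \<noteq> b \<and>
     (\<exists>P\<in>D. \<exists>P'\<in>D. ranked A 1 P = a \<and> ranked A 2 P' = a \<and>
        ranked A 1 P' = b \<and> ranked A 2 P = b \<and>
        (\<forall>k\<in>{3..card A}. ranked A k P = ranked A k P'))"

(* The undirected adjacency graph on A, given by its symmetric edge relation. *)
definition adjacency_edges :: "'a set \<Rightarrow> 'a rel set \<Rightarrow> 'a rel" where
  "adjacency_edges A D = {(a, b). a \<in> A \<and> b \<in> A \<and> adjacent A D a b}"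

definition path_connected_domain :: "'a set \<Rightarrow> 'a rel set \<Rightarrow> bool" where
  "path_connected_domain A D \<longleftrightarrow> (\<forall>a\<in>A. \<forall>b\<in>A. (a, b) \<in> (adjacency_edges A D)\<^sup>*)"

definition neighbors :: "'a set \<Rightarrow> 'a rel set \<Rightarrow> 'a \<Rightarrow> 'a set" where
  "neighbors A D x = {y. (x, y) \<in> adjacency_edges A D}"

definition leaves :: "'a set \<Rightarrow> 'a rel set \<Rightarrow> 'a set" where
  "leaves A D = {x \<in> A. card (neighbors A D x) = 1}"

definition leaf_symmetry :: "'a set \<Rightarrow> 'a rel set \<Rightarrow> bool" where
  "leaf_symmetry A D \<longleftrightarrow>
     (\<forall>x\<in>leaves A D. card (seconds A D x) > 1 \<longrightarrow>
        (\<exists>z\<in>seconds A D x. z \<notin> neighbors A D x \<and> x \<in> seconds A D z))"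

definition unique_seconds :: "'a set \<Rightarrow> 'a rel set \<Rightarrow> bool" where
  "unique_seconds A D \<longleftrightarrow> (\<exists>x\<in>A. card (seconds A D x) = 1)"

end

(* Without unique seconds, leaf symmetry gives every alternative at least two others with which it
   forms a pair of mutual seconds, at least one of them adjacent. For two voters and mutual seconds
   a, b, the outcome at the peaks (a, b) names a winning voter, depending only on a and b; a winner
   with peak a against b also wins with peak b against any further mutual second c of b, provided
   that one of the two steps a, b and b, c is an adjacency. If a were chosen over b whoever
   reports a, this could be continued to an infinite walk along which the set of beaten
   alternatives strictly shrinks. So each pair has the same winner in both orders, and
   connectedness makes this voter a dictator. For n voters, a minimal coalition that is decisive
   when both it and its complement vote as blocs is a singleton, by the two-voter case, and its
   member dictates. *)

theory Submission
  imports Defs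
begin

section \<open>Positions in a strict linear order on a finite set\<close>

section \<open>Ranks\<close>

text \<open>Keeps the \<open>1\<close> in \<open>peak A P\<close>, which abbreviates
  \<open>ranked A 1 P\<close>, from turning into \<open>Suc 0\<close>.\<close>

declare One_nat_def [simp del]

text \<open>Inverse of \<open>ranked A k P\<close> as a function of \<open>k\<close>: the
  description in \<open>ranked\<close> asks for the \<open>x\<close> in \<open>A\<close> with
  \<open>rank A P x = k\<close>.\<close>

definition rank :: "'a set \<Rightarrow> 'a rel \<Rightarrow> 'a \<Rightarrow> nat" where
  "rank A P x = card {y \<in> A. (y, x) \<in> P} + 1"

lemma preferenceD:
  assumes "preference A P"
  shows "P \<subseteq> A \<times> A" "trans P" "irrefl P" "total_on A P"
  using assms by (auto simp: preference_def strict_linear_order_on_def)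

lemma rank_strict_mono:
  assumes "finite A" "preference A P" "(x, y) \<in> P"
  shows "rank A P x < rank A P y"
proof -
  have "{z \<in> A. (z, x) \<in> P} \<subset> {z \<in> A. (z, y) \<in> P}"
    using preferenceD[OF assms(2)] assms(3) by (auto simp: irrefl_def dest: transD)
  then show ?thesis
    using assms(1) by (simp add: rank_def psubset_card_mono)
qed

lemma rank_less_iff:
  assumes "finite A" "preference A P" "x \<in> A" "y \<in> A"
  shows "rank A P x < rank A P y \<longleftrightarrow> (x, y) \<in> P"
proof
  assume less: "rank A P x < rank A P y"
  then have "(y, x) \<notin> P" "x \<noteq> y"
    using rank_strict_mono[OF assms(1,2), of y x] by auto
  then show "(x, y) \<in> P"
    using preferenceD(4)[OF assms(2)] assms(3,4) by (auto simp: total_on_def)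
qed (rule rank_strict_mono[OF assms(1,2)])

lemma rank_inj_on:
  assumes "finite A" "preference A P"
  shows "inj_on (rank A P) A"
proof (rule inj_onI)
  fix x y assume "x \<in> A" "y \<in> A" "rank A P x = rank A P y"
  then show "x = y"
    using rank_less_iff[OF assms] preferenceD(4)[OF assms(2)]
    unfolding total_on_def by (metis less_irrefl)
qed

text \<open>No alternative is preferred to itself, so ranks are at most \<open>card A\<close>; an
  injective map from \<open>A\<close> into a set of the same size is onto.\<close>

lemma rank_image:
  assumes "finite A" "preference A P"
  shows "rank A P ` A = {1..card A}"
proof (rule card_subset_eq)
  have "rank A P x \<le> card A" if "x \<in> A" for x
  proof -
    have "{y \<in> A. (y, x) \<in> P} \<subset> A"
      using that preferenceD(3)[OF assms(2)] by (auto simp: irrefl_def)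
    then show ?thesis
      using psubset_card_mono[OF assms(1)] by (metis rank_def Suc_eq_plus1 Suc_leI)
  qed
  then show "rank A P ` A \<subseteq> {1..card A}"
    by (auto simp: rank_def)
  show "card (rank A P ` A) = card {1..card A}"
    using card_image[OF rank_inj_on[OF assms]] by simp
qed simp

lemma ranked_rank:
  assumes "finite A" "preference A P" "x \<in> A"
  shows "ranked A (rank A P x) P = x"
  unfolding ranked_def rank_def[symmetric]
  using assms(3) rank_inj_on[OF assms(1,2)] by (auto intro!: the_equality dest: inj_onD)

lemma rank_ranked:
  assumes "finite A" "preference A P" "k \<in> {1..card A}"
  shows "ranked A k P \<in> A" "rank A P (ranked A k P) = k"
proof -
  obtain x where "x \<in> A" "rank A P x = k"
    using assms(3) unfolding rank_image[OF assms(1,2), symmetric] by auto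
  then show "ranked A k P \<in> A" "rank A P (ranked A k P) = k"
    using ranked_rank[OF assms(1,2)] by auto
qed

lemma ranked_preferred:
  assumes "finite A" "preference A P" "k \<in> {1..card A}" "y \<in> A"
    and "\<And>j. j \<in> {1..k} \<Longrightarrow> y \<noteq> ranked A j P"
  shows "(ranked A k P, y) \<in> P"
proof -
  have "rank A P y \<notin> {1..k}"
    using assms(5)[of "rank A P y"] ranked_rank[OF assms(1,2,4)] by auto
  moreover have "rank A P y \<ge> 1"
    by (simp add: rank_def)
  ultimately have "rank A P (ranked A k P) < rank A P y"
    using rank_ranked(2)[OF assms(1-3)] by auto
  then show ?thesis
    using rank_less_iff[OF assms(1,2)] rank_ranked(1)[OF assms(1-3)] assms(4) by blast
qed

section \<open>Order facts and adjacency in a fixed domain\<close>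

locale preference_domain =
  fixes A :: "'a set" and D :: "'a rel set"
  assumes finite_alts: "finite A" and card_alts: "card A \<ge> 3" and dom: "is_domain A D"
begin

lemma pref: "P \<in> D \<Longrightarrow> preference A P"
  using dom by (auto simp: is_domain_def)

lemma asymP: "P \<in> D \<Longrightarrow> (x, y) \<in> P \<Longrightarrow> (y, x) \<notin> P"
  using preferenceD[OF pref] by (meson irrefl_def transD)

lemma transP: "P \<in> D \<Longrightarrow> (x, y) \<in> P \<Longrightarrow> (y, z) \<in> P \<Longrightarrow> (x, z) \<in> P"
  using preferenceD(2)[OF pref] by (meson transD)

lemma totalP: "P \<in> D \<Longrightarrow> x \<in> A \<Longrightarrow> y \<in> A \<Longrightarrow> x \<noteq> y \<Longrightarrow> (x, y) \<in> P \<or> (y, x) \<in> P"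
  using preferenceD(4)[OF pref] by (auto simp: total_on_def)

lemma peak_in: "P \<in> D \<Longrightarrow> peak A P \<in> A"
  using rank_ranked(1)[OF finite_alts pref, of P 1] card_alts by auto

lemma second_in: "P \<in> D \<Longrightarrow> ranked A 2 P \<in> A"
  using rank_ranked(1)[OF finite_alts pref, of P 2] card_alts by auto

lemma second_neq_peak:
  assumes "P \<in> D"
  shows "ranked A 2 P \<noteq> peak A P"
proof
  assume "ranked A 2 P = peak A P"
  then show False
    using rank_ranked(2)[OF finite_alts pref[OF assms], of 1]
      rank_ranked(2)[OF finite_alts pref[OF assms], of 2] card_alts by auto
qed

lemma peak_preferred: "P \<in> D \<Longrightarrow> y \<in> A \<Longrightarrow> y \<noteq> peak A P \<Longrightarrow> (peak A P, y) \<in> P"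
  using ranked_preferred[OF finite_alts pref, of P 1 y] card_alts by (auto simp: le_antisym)

lemma second_preferred:
  assumes "P \<in> D" "y \<in> A" "y \<noteq> peak A P" "y \<noteq> ranked A 2 P"
  shows "(ranked A 2 P, y) \<in> P"
proof (rule ranked_preferred[OF finite_alts pref])
  fix j :: nat assume "j \<in> {1..2}"
  then have "j = 1 \<or> j = 2" by auto
  then show "y \<noteq> ranked A j P" using assms by auto
qed (use assms card_alts in auto)

lemma peak_domainD: "P \<in> peak_domain A D a \<Longrightarrow> P \<in> D \<and> peak A P = a"
  by (simp add: peak_domain_def)

lemma secondsE:
  assumes "b \<in> seconds A D a"
  obtains P where "P \<in> D" "peak A P = a" "ranked A 2 P = b" "a \<in> A" "b \<in> A" "a \<noteq> b"
  using assms peak_in second_in second_neq_peak by (fastforce simp: seconds_def peak_domain_def)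

lemma adjacent_sym: "adjacent A D a b \<Longrightarrow> adjacent A D b a"
  unfolding adjacent_def by metis

lemma adjacent_seconds:
  assumes "adjacent A D a b"
  shows "b \<in> seconds A D a"
proof -
  obtain P where "P \<in> D" "peak A P = a" "ranked A 2 P = b"
    using assms unfolding adjacent_def by metis
  then show ?thesis by (auto simp: seconds_def peak_domain_def)
qed

text \<open>Agreement at all positions from 3 on gives every alternative other than \<open>a\<close>
  and \<open>b\<close> the same rank in both preferences, so these are ordered alike.\<close>

lemma adjacentE:
  assumes "adjacent A D a b"
  obtains P Q where "P \<in> D" "Q \<in> D" "peak A P = a" "ranked A 2 P = b" "peak A Q = b" "ranked A 2 Q = a"
    "\<And>x y. x \<in> A \<Longrightarrow> y \<in> A \<Longrightarrow> x \<notin> {a, b} \<Longrightarrow> y \<notin> {a, b} \<Longrightarrow> (x, y) \<in> P \<longleftrightarrow> (x, y) \<in> Q"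
proof -
  obtain P Q where PQ: "P \<in> D" "Q \<in> D" "peak A P = a" "ranked A 2 P = b" "peak A Q = b" "ranked A 2 Q = a"
    and same: "\<And>k. k \<in> {3..card A} \<Longrightarrow> ranked A k P = ranked A k Q"
    using assms unfolding adjacent_def by metis
  have rk: "rank A P x = rank A Q x" if x: "x \<in> A" "x \<notin> {a, b}" for x
  proof -
    have eq: "ranked A (rank A P x) P = x"
      using ranked_rank[OF finite_alts pref] PQ(1) x(1) by auto
    have "rank A P x \<in> {1..card A}"
      using rank_image[OF finite_alts pref[OF PQ(1)]] x(1) by auto
    moreover have "rank A P x \<noteq> 1" "rank A P x \<noteq> 2"
      using eq PQ(3,4) x(2) by auto
    ultimately have k: "rank A P x \<in> {3..card A}" by auto
    show ?thesis
      using rank_ranked(2)[OF finite_alts pref[OF PQ(2)], of "rank A P x"] same[OF k] eq k by auto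
  qed
  show thesis
  proof (rule that[OF PQ])
    fix x y assume "x \<in> A" "y \<in> A" "x \<notin> {a, b}" "y \<notin> {a, b}"
    then show "(x, y) \<in> P \<longleftrightarrow> (x, y) \<in> Q"
      using rk[of x] rk[of y] rank_less_iff[OF finite_alts pref[OF PQ(1)], of x y]
        rank_less_iff[OF finite_alts pref[OF PQ(2)], of x y] by auto
  qed
qed

end

section \<open>Outcomes of two-voter rules at mutual seconds\<close>

section \<open>Two voters\<close>

text \<open>Unanimity is assumed only for identical reports, which is what two blocs in a larger
  electorate supply; \<open>unan\<close> extends it to equal peaks.\<close>

locale two_voter_rule = preference_domain A D
  for A :: "'a set" and D :: "'a rel set" +
  fixes g :: "'a rel \<Rightarrow> 'a rel \<Rightarrow> 'a"
  assumes range: "P \<in> D \<Longrightarrow> Q \<in> D \<Longrightarrow> g P Q \<in> A"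
    and unan_same: "P \<in> D \<Longrightarrow> g P P = peak A P"
    and sp1: "P \<in> D \<Longrightarrow> P' \<in> D \<Longrightarrow> Q \<in> D \<Longrightarrow> g P Q = g P' Q \<or> (g P Q, g P' Q) \<in> P"
    and sp2: "P \<in> D \<Longrightarrow> Q \<in> D \<Longrightarrow> Q' \<in> D \<Longrightarrow> g P Q = g P Q' \<or> (g P Q, g P Q') \<in> Q"
begin

abbreviation swapped :: "'a rel \<Rightarrow> 'a rel \<Rightarrow> 'a" where
  "swapped \<equiv> \<lambda>P Q. g Q P"

lemma swap: "two_voter_rule A D swapped"
  by unfold_locales (use range unan_same sp1 sp2 in auto)

end

text \<open>Voter 1 with peak \<open>a\<close> prevails against voter 2 with peak \<open>b\<close>.
  At the same peaks, \<open>wins A D swapped b a\<close> says that voter 2 prevails.\<close>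

definition wins :: "'a set \<Rightarrow> 'a rel set \<Rightarrow> ('a rel \<Rightarrow> 'a rel \<Rightarrow> 'a) \<Rightarrow> 'a \<Rightarrow> 'a \<Rightarrow> bool" where
  "wins A D g a b \<longleftrightarrow> (\<forall>P\<in>peak_domain A D a. \<forall>Q\<in>peak_domain A D b. g P Q = a)"

context two_voter_rule
begin

lemma winsD: "wins A D g a b \<Longrightarrow> P \<in> D \<Longrightarrow> Q \<in> D \<Longrightarrow> peak A P = a \<Longrightarrow> peak A Q = b \<Longrightarrow> g P Q = a"
  by (simp add: wins_def peak_domain_def)

text \<open>Otherwise voter 1 would gain its peak by reporting \<open>P'\<close>.\<close>

lemma peak_attained:
  assumes "P \<in> D" "P' \<in> D" "Q \<in> D" "g P' Q = peak A P"
  shows "g P Q = peak A P"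
  using sp1[OF assms(1-3)] assms(4) peak_preferred[OF assms(1) range[OF assms(1,3)]]
    asymP[OF assms(1)] by metis

lemma unan: "P \<in> D \<Longrightarrow> Q \<in> D \<Longrightarrow> peak A P = peak A Q \<Longrightarrow> g P Q = peak A P"
  using peak_attained[of P Q Q] unan_same by simp

text \<open>Reporting \<open>P'\<close> secures the second-ranked alternative, and truth-telling
  cannot do worse.\<close>

lemma second_attained:
  assumes "P \<in> D" "P' \<in> D" "Q \<in> D" "g P' Q = ranked A 2 P"
  shows "g P Q \<in> {peak A P, ranked A 2 P}"
  using sp1[OF assms(1-3)] assms(4) second_preferred[OF assms(1) range[OF assms(1,3)]]
    asymP[OF assms(1)] by (metis insertCI)

lemma winsI:
  assumes P: "P \<in> D" "peak A P = a" "\<And>Q. Q \<in> D \<Longrightarrow> peak A Q = b \<Longrightarrow> g P Q = a"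
  shows "wins A D g a b"
  unfolding wins_def using P peak_attained by (metis peak_domainD)

text \<open>Against any \<open>R\<close> with peak \<open>b\<close>, voter 1 can get its second
  \<open>b\<close> by copying the report, so the outcome is \<open>a\<close> or \<open>b\<close>. If
  it were \<open>b\<close>, voter 2 would manipulate from \<open>Q\<close> to \<open>R\<close>. By
  \<open>winsI\<close>, one preference of voter 1 is enough.\<close>

lemma wins_if_top_pair:
  assumes P: "P \<in> D" "peak A P = a" "ranked A 2 P = b"
    and Q: "Q \<in> D" "peak A Q = b" "ranked A 2 Q = a" and "g P Q = a"
  shows "wins A D g a b"
proof (rule winsI[OF P(1,2)])
  fix R assume R: "R \<in> D" "peak A R = b"
  have "a \<noteq> b" using second_neq_peak[OF P(1)] P by auto
  have "g P R \<in> {a, b}"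
    using second_attained[OF P(1) R(1) R(1)] unan[OF R(1) R(1)] R P by auto
  moreover have "g P R \<noteq> b"
  proof
    assume "g P R = b"
    then have "(a, b) \<in> Q"
      using sp2[OF P(1) Q(1) R(1)] assms(7) \<open>a \<noteq> b\<close> by auto
    then show False
      using asymP[OF Q(1)] peak_preferred[OF Q(1), of a] Q P \<open>a \<noteq> b\<close> peak_in by metis
  qed
  ultimately show "g P R = a" by auto
qed

lemma wins_dichotomy:
  assumes "b \<in> seconds A D a" "a \<in> seconds A D b"
  shows "wins A D g a b \<or> wins A D swapped b a"
proof -
  obtain P where P: "P \<in> D" "peak A P = a" "ranked A 2 P = b" using assms(1) by (rule secondsE)
  obtain Q where Q: "Q \<in> D" "peak A Q = b" "ranked A 2 Q = a" using assms(2) by (rule secondsE)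
  have "g P Q \<in> {a, b}"
    using second_attained[OF P(1) Q(1) Q(1)] unan[OF Q(1) Q(1)] P Q by auto
  then show ?thesis
    using wins_if_top_pair[OF P Q] two_voter_rule.wins_if_top_pair[OF swap Q P] by auto
qed

lemma wins_not_swapped:
  assumes "wins A D g a b" "b \<in> seconds A D a" "a \<in> seconds A D b"
  shows "\<not> wins A D swapped b a"
proof
  assume w: "wins A D swapped b a"
  obtain P where P: "P \<in> D" "peak A P = a" "a \<noteq> b" using assms(2) by (rule secondsE)
  obtain Q where Q: "Q \<in> D" "peak A Q = b" using assms(3) by (rule secondsE)
  show False
    using winsD[OF assms(1) P(1) Q(1)] two_voter_rule.winsD[OF swap w Q(1) P(1)] P Q by auto
qed

text \<open>Voter 1 with second \<open>b\<close> can pretend to have peak \<open>b\<close> and so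
  gets \<open>a\<close> or \<open>b\<close> against \<open>y\<close>. The outcome \<open>b\<close>
  is excluded: voter 2 with peak \<open>b\<close> could then obtain \<open>b\<close> against
  \<open>P\<close> by reporting \<open>Q\<close>.\<close>

lemma wins_trans:
  assumes "wins A D g a b" "b \<in> seconds A D a" "wins A D g b y" "peak_domain A D b \<noteq> {}"
  shows "wins A D g a y"
proof -
  obtain P where P: "P \<in> D" "peak A P = a" "ranked A 2 P = b" "a \<noteq> b"
    using assms(2) by (rule secondsE)
  obtain R where R: "R \<in> D" "peak A R = b" using assms(4) peak_domainD by blast
  show ?thesis
  proof (rule winsI[OF P(1,2)])
    fix Q assume Q: "Q \<in> D" "peak A Q = y"
    have "g R Q = b" using winsD[OF assms(3)] R Q by auto
    then have "g P Q \<in> {a, b}" using second_attained[OF P(1) R(1) Q(1)] P by auto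
    moreover have "g P Q \<noteq> b"
    proof
      assume "g P Q = b"
      then have "g P R = b"
        using two_voter_rule.peak_attained[OF swap R(1) Q(1) P(1)] R by auto
      then show False using winsD[OF assms(1) P(1) R(1)] P R by auto
    qed
    ultimately show "g P Q = a" by auto
  qed
qed

text \<open>Suppose voter 2 won with \<open>c\<close>. Voter 1 reporting peak \<open>a\<close> gets
  \<open>a\<close> against \<open>Q\<close> and, since \<open>Q'\<close> only exchanges the top two,
  also against \<open>Q'\<close>. With peak \<open>b\<close> and second \<open>a\<close> it would
  then get \<open>b\<close> or \<open>a\<close> against \<open>Q'\<close>, never
  \<open>c\<close>.\<close>

lemma wins_adjacent_swap:
  assumes w: "wins A D g a b" and ab: "a \<in> seconds A D b" "peak_domain A D a \<noteq> {}"
    and bc: "adjacent A D b c" and "c \<noteq> a"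
  shows "\<not> wins A D swapped c b"
proof
  assume w': "wins A D swapped c b"
  obtain Q Q' where Q: "Q \<in> D" "peak A Q = b" "ranked A 2 Q = c"
    and Q': "Q' \<in> D" "peak A Q' = c" "ranked A 2 Q' = b"
    and same: "\<And>x y. x \<in> A \<Longrightarrow> y \<in> A \<Longrightarrow> x \<notin> {b, c} \<Longrightarrow> y \<notin> {b, c} \<Longrightarrow> (x, y) \<in> Q \<longleftrightarrow> (x, y) \<in> Q'"
    using bc by (rule adjacentE) blast
  obtain R where R: "R \<in> D" "peak A R = a" using ab(2) peak_domainD by blast
  obtain P where P: "P \<in> D" "peak A P = b" "ranked A 2 P = a" "a \<in> A" "a \<noteq> b"
    using ab(1) by (rule secondsE) auto
  have cA: "c \<in> A" "b \<in> A" using peak_in[OF Q(1)] peak_in[OF Q'(1)] Q Q' by auto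
  have RQ: "g R Q = a" using winsD[OF w R(1) Q(1)] R Q by auto
  define d where "d = g R Q'"
  have dA: "d \<in> A" unfolding d_def using range R Q' by auto
  \<comment> \<open>Neither change between \<open>Q\<close> and \<open>Q'\<close> may profit voter
    2. In \<open>Q\<close>, \<open>a\<close> lies below \<open>b\<close> and \<open>c\<close>, hence
    so does \<open>d\<close>; there \<open>Q\<close> and \<open>Q'\<close> agree, which forces
    \<open>d = a\<close>.\<close>
  have down: "a = d \<or> (a, d) \<in> Q" using sp2[OF R(1) Q(1) Q'(1)] RQ d_def by auto
  have up: "d = a \<or> (d, a) \<in> Q'" using sp2[OF R(1) Q'(1) Q(1)] RQ d_def by auto
  have "(b, a) \<in> Q" "(c, a) \<in> Q"
    using peak_preferred[OF Q(1), of a] second_preferred[OF Q(1), of a] Q P \<open>c \<noteq> a\<close> by auto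
  then have "d \<noteq> b" "d \<noteq> c" using down asymP[OF Q(1)] P \<open>c \<noteq> a\<close> by auto
  then have "d = a" using down up same[of d a] P \<open>c \<noteq> a\<close> dA asymP[OF Q(1)] by auto
  then have "g R Q' = a" by (simp add: d_def)
  then have "g P Q' \<in> {b, a}" using second_attained[OF P(1) R(1) Q'(1)] P by auto
  moreover have "g P Q' = c"
    using two_voter_rule.winsD[OF swap w' Q'(1) P(1)] P Q' by auto
  moreover have "b \<noteq> c" using second_neq_peak[OF Q(1)] Q by auto
  ultimately show False using \<open>c \<noteq> a\<close> by auto
qed

end

section \<open>Neighbours in the adjacency graph\<close>

context preference_domain
begin

lemma obtains_distinct:
  assumes "a \<in> A"
  obtains b where "b \<in> A" "b \<noteq> a"
proof -
  have "A \<noteq> {a}" using card_alts by auto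
  then show thesis using assms that by blast
qed

lemma neighborsD:
  assumes "b \<in> neighbors A D a"
  shows "adjacent A D a b" "a \<in> A" "b \<in> A"
  using assms by (auto simp: neighbors_def adjacency_edges_def)

lemma neighbors_mem: "adjacent A D a b \<Longrightarrow> b \<in> neighbors A D a"
  using adjacent_seconds[of a b] unfolding neighbors_def adjacency_edges_def
  by (auto elim: secondsE)

lemma exists_neighbor:
  assumes "path_connected_domain A D" "a \<in> A"
  obtains b where "adjacent A D a b"
proof -
  obtain b where "b \<in> A" "b \<noteq> a" using assms(2) by (rule obtains_distinct)
  then have "(a, b) \<in> (adjacency_edges A D)\<^sup>*"
    using assms unfolding path_connected_domain_def by blast
  then obtain c where "(a, c) \<in> adjacency_edges A D"
    using \<open>b \<noteq> a\<close> by (metis converse_rtranclE)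
  then show thesis using that by (auto simp: adjacency_edges_def)
qed

lemma exists_peak:
  assumes "path_connected_domain A D" "a \<in> A"
  shows "peak_domain A D a \<noteq> {}"
  using exists_neighbor[OF assms] adjacent_seconds unfolding seconds_def by blast

end

locale non_unique_seconds = preference_domain +
  assumes connected: "path_connected_domain A D"
    and leaf_sym: "leaf_symmetry A D"
    and no_unique: "\<not> unique_seconds A D"
begin

text \<open>If \<open>b\<close> has a neighbour other than \<open>a\<close>, take it. Otherwise
  \<open>b\<close> is a leaf attached to \<open>a\<close>, and leaf symmetry supplies a mutual
  second that is no neighbour and hence differs from \<open>a\<close>.\<close>

lemma other_neighbor:
  assumes "a \<in> seconds A D b" "b \<in> seconds A D a"
  obtains c where "c \<noteq> a" "c \<in> seconds A D b" "b \<in> seconds A D c"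
    "adjacent A D a b \<or> adjacent A D b c"
proof -
  have bA: "b \<in> A" using assms(1) by (rule secondsE)
  obtain c where c: "adjacent A D b c" using exists_neighbor[OF connected bA] .
  show thesis
  proof (cases "\<exists>c. adjacent A D b c \<and> c \<noteq> a")
    case True
    then show thesis using that adjacent_seconds adjacent_sym by blast
  next
    case False
    then have "c = a" using c by blast
    then have ab: "adjacent A D b a" using c by simp
    have nb: "neighbors A D b = {a}"
      using False neighborsD(1) neighbors_mem[OF ab] by blast
    then have "b \<in> leaves A D" using bA by (simp add: leaves_def)
    moreover have "card (seconds A D b) > 1"
    proof -
      have "seconds A D b \<subseteq> A" using secondsE by blast
      then have "finite (seconds A D b)" using finite_alts finite_subset by blast
      then have "card (seconds A D b) \<noteq> 0" using assms(1) by auto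
      moreover have "card (seconds A D b) \<noteq> 1"
        using no_unique bA by (auto simp: unique_seconds_def)
      ultimately show ?thesis by auto
    qed
    ultimately obtain z where "z \<in> seconds A D b" "z \<notin> neighbors A D b" "b \<in> seconds A D z"
      using leaf_sym unfolding leaf_symmetry_def by blast
    then show thesis using that nb adjacent_sym[OF ab] by auto
  qed
qed

end

section \<open>Two-voter rules when no second is unique\<close>

locale non_unique_two_voter_rule = non_unique_seconds A D + two_voter_rule A D g
  for A :: "'a set" and D :: "'a rel set" and g
begin

lemma swap_rule: "non_unique_two_voter_rule A D swapped"
  by (intro non_unique_two_voter_rule.intro non_unique_seconds_axioms swap)

text \<open>If voter 2 won with \<open>c\<close> against \<open>b\<close>, then
  \<open>wins_adjacent_swap\<close> would fail: at the step from \<open>b\<close> to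
  \<open>c\<close> if these are adjacent, and with the voters exchanged at the step from
  \<open>b\<close> to \<open>a\<close> if those are.\<close>

lemma wins_step:
  assumes w: "wins A D g a b" and ab: "a \<in> seconds A D b" "b \<in> seconds A D a"
    and bc: "b \<in> seconds A D c" "c \<in> seconds A D b" and ne: "c \<noteq> a"
    and adj: "adjacent A D a b \<or> adjacent A D b c"
  shows "wins A D g b c"
proof (rule ccontr)
  assume "\<not> wins A D g b c"
  then have w': "wins A D swapped c b" using wins_dichotomy[OF bc(2,1)] by auto
  have ne': "peak_domain A D a \<noteq> {}" "peak_domain A D c \<noteq> {}"
    using exists_peak[OF connected] ab(2) bc(1) by (auto elim: secondsE)
  show False
    using adj
  proof
    assume "adjacent A D b c"
    then show False using wins_adjacent_swap[OF w ab(1) ne'(1) _ ne] w' by auto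
  next
    assume "adjacent A D a b"
    then show False
      using two_voter_rule.wins_adjacent_swap[OF swap w' bc(2) ne'(2) adjacent_sym] ne w by auto
  qed
qed

text \<open>Success that does not depend on who reports \<open>a\<close>. Unanimity makes the
  relation reflexive, which yields the strict inclusion in \<open>not_beats\<close>.\<close>

definition beats :: "'a \<Rightarrow> 'a \<Rightarrow> bool" where
  "beats a b \<longleftrightarrow> wins A D g a b \<and> wins A D swapped a b"

text \<open>A pair \<open>a\<close>, \<open>b\<close> of mutual seconds with \<open>beats a b\<close> can be continued by some \<open>c\<close> with
  \<open>beats b c\<close>, while the set of alternatives beaten by the second component strictly shrinks.\<close>

lemma not_beats: "a \<in> seconds A D b \<Longrightarrow> b \<in> seconds A D a \<Longrightarrow> \<not> beats a b"
proof (induction "card {y \<in> A. beats b y}" arbitrary: a b rule: less_induct)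
  case less
  show ?case
  proof
    assume ab: "beats a b"
    obtain c where c: "c \<noteq> a" "c \<in> seconds A D b" "b \<in> seconds A D c"
      "adjacent A D a b \<or> adjacent A D b c"
      using other_neighbor[OF less.prems] .
    have bc: "beats b c"
      using ab wins_step[OF _ less.prems c(3,2,1,4)]
        non_unique_two_voter_rule.wins_step[OF swap_rule _ less.prems c(3,2,1,4)]
      unfolding beats_def by auto
    have bA: "b \<in> A" using c(2) by (rule secondsE)
    have cA: "c \<in> A" "peak_domain A D c \<noteq> {}"
      using c(2) exists_peak[OF connected] by (auto elim: secondsE)
    have irr: "\<not> beats c b"
      using bc wins_not_swapped[OF _ c(2,3)] unfolding beats_def by auto
    have "beats b y" if "beats c y" for y
      using that bc wins_trans[OF _ c(2) _ cA(2)] two_voter_rule.wins_trans[OF swap _ c(2) _ cA(2)]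
      unfolding beats_def by auto
    moreover have "beats b b" using unan unfolding beats_def wins_def peak_domain_def by auto
    \<comment> \<open>The inclusion is transitivity through \<open>c\<close>; it is strict because
      \<open>b\<close> beats itself while \<open>c\<close> does not beat \<open>b\<close>.\<close>
    ultimately have "{y \<in> A. beats c y} \<subset> {y \<in> A. beats b y}"
      using irr bA by auto
    then have "card {y \<in> A. beats c y} < card {y \<in> A. beats b y}"
      using finite_alts by (simp add: psubset_card_mono)
    then show False using less.hyps[OF _ c(3,2)] bc by blast
  qed
qed

text \<open>If voter 1 did not win with the peaks exchanged, voter 2 would win there with
  \<open>a\<close>, and then \<open>beats a b\<close>.\<close>

lemma wins_sym:
  assumes "a \<in> seconds A D b" "b \<in> seconds A D a" "wins A D g a b"
  shows "wins A D g b a"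
  using wins_dichotomy[OF assms(1,2)] not_beats[OF assms(1,2)] assms(3) by (auto simp: beats_def)

text \<open>A win on an edge is reversed by \<open>wins_sym\<close> and passed through the common
  vertex to the next edge by \<open>wins_step\<close>; connectedness carries it to every
  edge.\<close>

lemma adjacent_wins:
  assumes "adjacent A D a b" "wins A D g a b" "v \<in> A" "adjacent A D v w"
  shows "wins A D g v w"
proof -
  have turn: "wins A D g v w'" if vw: "adjacent A D v w" "wins A D g v w" and w': "adjacent A D v w'"
    for v w w'
  proof (cases "w' = w")
    case False
    have "wins A D g w v"
      using vw wins_sym adjacent_seconds adjacent_sym by blast
    then show ?thesis
      using wins_step[of w v w'] False vw w' adjacent_seconds adjacent_sym by blast
  qed (use vw in simp)
  have "a \<in> A" using adjacent_seconds[OF assms(1)] by (rule secondsE)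
  then have "(a, v) \<in> (adjacency_edges A D)\<^sup>*"
    using connected assms(3) by (auto simp: path_connected_domain_def)
  then show ?thesis using assms(4)
  proof (induction arbitrary: w rule: rtrancl_induct)
    case base
    then show ?case using turn assms(1,2) by blast
  next
    case (step u v)
    have uv: "adjacent A D u v" using step.hyps(2) by (simp add: adjacency_edges_def)
    have "wins A D g v u"
      using step.IH[OF uv] wins_sym uv adjacent_seconds adjacent_sym by blast
    then show ?case using turn uv adjacent_sym step.prems by blast
  qed
qed

text \<open>Along a path starting at \<open>y\<close>, each new vertex wins over the preceding one,
  so \<open>wins_trans\<close> extends the win over \<open>y\<close>, which begins as
  unanimity.\<close>

lemma all_wins:
  assumes "adjacent A D a b" "wins A D g a b" "x \<in> A" "y \<in> A"
  shows "wins A D g x y"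
proof -
  have "(y, x) \<in> (adjacency_edges A D)\<^sup>*"
    using connected assms(3,4) by (auto simp: path_connected_domain_def)
  then show ?thesis
  proof (induction rule: rtrancl_induct)
    case base
    then show ?case using unan by (auto simp: wins_def peak_domain_def)
  next
    case (step u v)
    then have uv: "adjacent A D v u" "u \<in> A" "v \<in> A"
      using adjacent_sym by (auto simp: adjacency_edges_def)
    then show ?case
      using wins_trans[OF adjacent_wins[OF assms(1,2) uv(3,1)] adjacent_seconds[OF uv(1)] step.IH]
        exists_peak[OF connected] by blast
  qed
qed

text \<open>A single adjacent pair reveals the dictator: whoever wins there wins everywhere, by
  \<open>all_wins\<close> for \<open>g\<close> or for \<open>swapped\<close>.\<close>

lemma one_voter_dictates:
  "(\<forall>P\<in>D. \<forall>Q\<in>D. g P Q = peak A P) \<or> (\<forall>P\<in>D. \<forall>Q\<in>D. g P Q = peak A Q)"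
proof -
  have "A \<noteq> {}" using card_alts by auto
  then obtain a where "a \<in> A" by blast
  then obtain b where ab: "adjacent A D a b" using exists_neighbor[OF connected] by blast
  then have "wins A D g a b \<or> wins A D swapped b a"
    using wins_dichotomy adjacent_seconds adjacent_sym by blast
  then show ?thesis
  proof
    assume w: "wins A D g a b"
    have "g P Q = peak A P" if "P \<in> D" "Q \<in> D" for P Q
      using winsD[OF all_wins[OF ab w peak_in[OF that(1)] peak_in[OF that(2)]] that] by simp
    then show ?thesis by blast
  next
    assume w: "wins A D swapped b a"
    have "g P Q = peak A Q" if "P \<in> D" "Q \<in> D" for P Q
      using two_voter_rule.winsD[OF swap non_unique_two_voter_rule.all_wins[OF swap_rule
            adjacent_sym[OF ab] w peak_in[OF that(2)] peak_in[OF that(1)]] that(2,1)] by simp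
    then show ?thesis by blast
  qed
qed

end

section \<open>Reduction of many voters to two blocs\<close>

section \<open>Many voters\<close>

definition duo :: "nat \<Rightarrow> nat set \<Rightarrow> 'a rel \<Rightarrow> 'a rel \<Rightarrow> nat \<Rightarrow> 'a rel" where
  "duo n S P R = (\<lambda>i\<in>{1..n}. if i \<in> S then P else R)"

definition trio :: "nat \<Rightarrow> nat set \<Rightarrow> nat set \<Rightarrow> 'a rel \<Rightarrow> 'a rel \<Rightarrow> 'a rel \<Rightarrow> nat \<Rightarrow> 'a rel" where
  "trio n S T P Q R = (\<lambda>i\<in>{1..n}. if i \<in> S then P else if i \<in> T then Q else R)"

lemma duo_profile: "P \<in> D \<Longrightarrow> R \<in> D \<Longrightarrow> duo n S P R \<in> profiles n D"
  by (auto simp: duo_def profiles_def)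

lemma trio_profile: "P \<in> D \<Longrightarrow> Q \<in> D \<Longrightarrow> R \<in> D \<Longrightarrow> trio n S T P Q R \<in> profiles n D"
  by (auto simp: trio_def profiles_def)

lemma duo_complement: "duo n ({1..n} - S) P R = duo n S R P"
  by (auto simp: duo_def restrict_def fun_eq_iff)

lemma override_profile:
  "p \<in> profiles n D \<Longrightarrow> P \<in> D \<Longrightarrow> T \<subseteq> {1..n} \<Longrightarrow> override_on p (\<lambda>_. P) T \<in> profiles n D"
  by (auto simp: profiles_def override_on_def PiE_def extensional_def)

locale n_voter_rule = preference_domain A D
  for A :: "'a set" and D :: "'a rel set" +
  fixes n :: nat and f :: "(nat \<Rightarrow> 'a rel) \<Rightarrow> 'a"
  assumes rule: "rule A D n f" and sp: "strategy_proof D n f"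
begin

lemma scf: "p \<in> profiles n D \<Longrightarrow> f p \<in> A"
  using rule by (auto simp: rule_def scf_def)

lemma unan: "p \<in> profiles n D \<Longrightarrow> a \<in> A \<Longrightarrow> (\<And>i. i \<in> {1..n} \<Longrightarrow> peak A (p i) = a) \<Longrightarrow> f p = a"
  using rule by (auto simp: rule_def unanimous_def)

lemma spD:
  "i \<in> {1..n} \<Longrightarrow> p \<in> profiles n D \<Longrightarrow> P \<in> D \<Longrightarrow> f p = f (p(i := P)) \<or> (f p, f (p(i := P))) \<in> p i"
  using sp by (auto simp: strategy_proof_def)

text \<open>The members of \<open>T\<close> switch one at a time. Each still holds \<open>P\<close>
  when switching, so no step improves the outcome according to \<open>P\<close>, and transitivity
  combines the steps.\<close>

lemma group_strategy_proof:
  assumes p: "p \<in> profiles n D" and P': "P' \<in> D" and P: "P \<in> D"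
    and "finite T" "T \<subseteq> {1..n}" "\<And>i. i \<in> T \<Longrightarrow> p i = P"
  shows "f p = f (override_on p (\<lambda>_. P') T) \<or> (f p, f (override_on p (\<lambda>_. P') T)) \<in> P"
  using assms(4-6)
proof (induction T)
  case (insert i T)
  let ?q = "override_on p (\<lambda>_. P') T"
  have "?q i = P" using insert.prems insert.hyps by (simp add: override_on_def)
  then have "f ?q = f (?q(i := P')) \<or> (f ?q, f (?q(i := P'))) \<in> P"
    using spD[of i ?q P'] override_profile[OF p P'] insert.prems P' by auto
  moreover have "f p = f ?q \<or> (f p, f ?q) \<in> P"
    using insert by auto
  ultimately show ?case
    using transP[OF P] by (metis override_on_insert)
qed simp

text \<open>One voter at a time: a voter holding \<open>Q\<close>, whose peak is the old outcome,
  could restore that outcome by reporting the former preference.\<close>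

lemma move_to_outcome:
  assumes p: "p \<in> profiles n D" and Q: "Q \<in> D" "peak A Q = f p"
    and "finite T" "T \<subseteq> {1..n}"
  shows "f (override_on p (\<lambda>_. Q) T) = f p"
  using assms(4,5)
proof (induction T)
  case (insert i T)
  let ?q = "override_on p (\<lambda>_. Q) T"
  let ?r = "?q(i := Q)"
  have q: "?q \<in> profiles n D" using override_profile[OF p Q(1)] insert.prems by auto
  have r: "?r \<in> profiles n D"
    using override_profile[OF p Q(1), of "insert i T"] insert.prems by (simp add: override_on_insert)
  have "?q i \<in> D" using q insert.prems by (auto simp: profiles_def)
  then have "f ?r = f ?q \<or> (f ?r, f ?q) \<in> Q"
    using spD[of i ?r "?q i"] r insert.prems by auto
  moreover have "f ?q = peak A Q" using insert Q by auto
  ultimately have "f ?r = peak A Q"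
    using peak_preferred[OF Q(1) scf[OF r]] asymP[OF Q(1)] by metis
  then show ?case unfolding override_on_insert Q(2) .
qed simp

definition decisive :: "nat set \<Rightarrow> bool" where
  "decisive S \<longleftrightarrow> (\<forall>P\<in>D. \<forall>R\<in>D. f (duo n S P R) = peak A P)"

text \<open>Group strategy-proofness lets each bloc act as one voter while the others stay fixed at
  \<open>R\<close>; the power of the union against \<open>R\<close> gives unanimity.\<close>

lemma two_groups_rule:
  assumes ST: "S \<subseteq> {1..n}" "T \<subseteq> {1..n}" "S \<inter> T = {}" and R: "R \<in> D"
    and dec: "\<And>P. P \<in> D \<Longrightarrow> f (duo n (S \<union> T) P R) = peak A P"
  shows "two_voter_rule A D (\<lambda>P Q. f (trio n S T P Q R))"
proof
  fix P Q Q' assume P: "P \<in> D" and Q: "Q \<in> D"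
  show "f (trio n S T P Q R) \<in> A"
    using scf[OF trio_profile[OF P Q R]] .
  have "trio n S T P P R = duo n (S \<union> T) P R"
    by (auto simp: trio_def duo_def restrict_def fun_eq_iff)
  then show "f (trio n S T P P R) = peak A P" using dec[OF P] by simp
  have fin: "finite S" "finite T" using ST finite_subset by blast+
  assume Q': "Q' \<in> D"
  have "trio n S T Q' Q R = override_on (trio n S T P Q R) (\<lambda>_. Q') S"
    "\<And>i. i \<in> S \<Longrightarrow> trio n S T P Q R i = P"
    using ST by (auto simp: trio_def override_on_def restrict_def fun_eq_iff)
  then show "f (trio n S T P Q R) = f (trio n S T Q' Q R) \<or>
      (f (trio n S T P Q R), f (trio n S T Q' Q R)) \<in> P"
    using group_strategy_proof[OF trio_profile[OF P Q R] Q' P fin(1) ST(1)] by simp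
  have "trio n S T P Q' R = override_on (trio n S T P Q R) (\<lambda>_. Q') T"
    "\<And>i. i \<in> T \<Longrightarrow> trio n S T P Q R i = Q"
    using ST by (auto simp: trio_def override_on_def restrict_def fun_eq_iff)
  then show "f (trio n S T P Q R) = f (trio n S T P Q' R) \<or>
      (f (trio n S T P Q R), f (trio n S T P Q' R)) \<in> Q"
    using group_strategy_proof[OF trio_profile[OF P Q R] Q' Q fin(2) ST(2)] by simp
qed

lemma decisive_all: "decisive {1..n}"
  unfolding decisive_def
proof (intro ballI)
  fix P R assume "P \<in> D" "R \<in> D"
  then show "f (duo n {1..n} P R) = peak A P"
    by (intro unan[OF duo_profile]) (auto simp: duo_def peak_in)
qed

end

locale non_unique_n_voter_rule = non_unique_seconds A D + n_voter_rule A D n f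
  for A :: "'a set" and D :: "'a rel set" and n f
begin

lemma two_groups_dictatorial:
  assumes "S \<subseteq> {1..n}" "T \<subseteq> {1..n}" "S \<inter> T = {}" "R \<in> D"
    and "\<And>P. P \<in> D \<Longrightarrow> f (duo n (S \<union> T) P R) = peak A P"
  shows "(\<forall>P\<in>D. \<forall>Q\<in>D. f (trio n S T P Q R) = peak A P) \<or>
    (\<forall>P\<in>D. \<forall>Q\<in>D. f (trio n S T P Q R) = peak A Q)"
  by (intro non_unique_two_voter_rule.one_voter_dictates non_unique_two_voter_rule.intro
      non_unique_seconds_axioms two_groups_rule assms)

lemma obtains_peak:
  assumes "a \<in> A"
  obtains P where "P \<in> D" "peak A P = a"
  using exists_peak[OF connected assms] peak_domainD by blast

lemma obtains_other_peak:
  assumes "P \<in> D"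
  obtains Q where "Q \<in> D" "peak A Q \<noteq> peak A P"
  using obtains_distinct[OF peak_in[OF assms]] obtains_peak by metis

lemma obtains_preference: obtains P where "P \<in> D"
proof -
  have "A \<noteq> {}" using card_alts by auto
  then show thesis using obtains_peak that by blast
qed

text \<open>The two-voter case applies to \<open>S\<close> and its complement; no voter is left to
  hold \<open>R\<close>, so the dictating bloc is decisive.\<close>

lemma decisive_or_complement:
  assumes "S \<subseteq> {1..n}"
  shows "decisive S \<or> decisive ({1..n} - S)"
proof -
  obtain R where R: "R \<in> D" by (rule obtains_preference)
  have "S \<union> ({1..n} - S) = {1..n}" using assms by auto
  then have "\<And>P. P \<in> D \<Longrightarrow> f (duo n (S \<union> ({1..n} - S)) P R) = peak A P"
    using decisive_all R by (simp add: decisive_def)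
  from two_groups_dictatorial[OF assms _ _ R this]
  have "(\<forall>P\<in>D. \<forall>Q\<in>D. f (trio n S ({1..n} - S) P Q R) = peak A P) \<or>
    (\<forall>P\<in>D. \<forall>Q\<in>D. f (trio n S ({1..n} - S) P Q R) = peak A Q)"
    by auto
  moreover have "trio n S ({1..n} - S) P Q R = duo n S P Q" for P Q
    by (auto simp: trio_def duo_def restrict_def fun_eq_iff)
  ultimately show ?thesis
    unfolding decisive_def duo_complement by metis
qed

lemma complement_not_decisive:
  assumes "P \<in> D" "Q \<in> D" "peak A P \<noteq> peak A Q" "f (duo n S P Q) = peak A P"
  shows "\<not> decisive ({1..n} - S)"
  using assms unfolding decisive_def duo_complement by metis

text \<open>Take a decisive coalition of least size. If it had more than one member, split off
  \<open>i\<close>: neither piece is decisive, so both complements are. Yet by the two-voter case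
  one piece prevails against all others voting \<open>R\<close>, a contradiction.\<close>

lemma decisive_voter: "\<exists>i\<in>{1..n}. decisive {i}"
proof -
  obtain R where R: "R \<in> D" by (rule obtains_preference)
  obtain P where P: "P \<in> D" "peak A P \<noteq> peak A R" using obtains_other_peak[OF R] .
  obtain S where S: "S \<subseteq> {1..n}" "decisive S"
    and minimal: "\<And>T. T \<subseteq> {1..n} \<Longrightarrow> decisive T \<Longrightarrow> card S \<le> card T"
    using ex_has_least_nat[of "\<lambda>S. S \<subseteq> {1..n} \<and> decisive S" "{1..n}" card] decisive_all by blast
  have "finite S" using S(1) finite_subset by blast
  have "S \<noteq> {}"
  proof
    assume "S = {}"
    then have "decisive ({1..n} - {1..n})" using S(2) by simp
    then show False
      using complement_not_decisive[OF P(1) R P(2), of "{1..n}"] decisive_all P R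
      by (auto simp: decisive_def)
  qed
  then obtain i where i: "i \<in> S" by blast
  have "S = {i}"
  proof (rule ccontr)
    let ?T = "S - {i}"
    assume "S \<noteq> {i}"
    then have "{i} \<subset> S" "?T \<subset> S" using i by auto
    then have "card {i} < card S" "card ?T < card S"
      using psubset_card_mono[OF \<open>finite S\<close>] by blast+
    moreover have sub: "{i} \<subseteq> {1..n}" "?T \<subseteq> {1..n}" using S(1) i by auto
    ultimately have "\<not> decisive {i}" "\<not> decisive ?T"
      using minimal not_le by blast+
    then have co: "decisive ({1..n} - {i})" "decisive ({1..n} - ?T)"
      using decisive_or_complement sub by blast+
    have un: "{i} \<union> ?T = S" using i by auto
    have "\<And>P. P \<in> D \<Longrightarrow> f (duo n ({i} \<union> ?T) P R) = peak A P"
      using S(2) R unfolding un decisive_def by blast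
    from two_groups_dictatorial[OF sub _ R this]
    \<comment> \<open>Whichever piece dictates reports \<open>P\<close>, and the other piece gets
      \<open>R\<close> like everyone else.\<close>
    have "f (trio n {i} ?T P R R) = peak A P \<or> f (trio n {i} ?T R P R) = peak A P"
      using P R by blast
    moreover have "trio n {i} ?T P R R = duo n {i} P R" "trio n {i} ?T R P R = duo n ?T P R"
      by (auto simp: trio_def duo_def restrict_def fun_eq_iff)
    ultimately show False
      using complement_not_decisive[OF P(1) R P(2)] co by auto
  qed
  then show ?thesis using S by auto
qed

text \<open>Let everybody but \<open>i\<close> switch to some \<open>Q\<close> whose peak is the
  outcome. The outcome stays, and now \<open>{i}\<close> faces a bloc, so it is the peak of
  \<open>p i\<close>.\<close>

lemma dictatorial: "dictatorship A D n f"
proof -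
  obtain i where i: "i \<in> {1..n}" "decisive {i}" using decisive_voter by blast
  have "f p = peak A (p i)" if p: "p \<in> profiles n D" for p
  proof -
    obtain Q where Q: "Q \<in> D" "peak A Q = f p" using obtains_peak[OF scf[OF p]] .
    have "p i \<in> D" using p i by (auto simp: profiles_def)
    then have "f (duo n {i} (p i) Q) = peak A (p i)"
      using i Q by (auto simp: decisive_def)
    moreover have "duo n {i} (p i) Q = override_on p (\<lambda>_. Q) ({1..n} - {i})"
      using p i by (auto simp: duo_def override_on_def profiles_def fun_eq_iff PiE_def extensional_def)
    ultimately show ?thesis
      using move_to_outcome[OF p Q, of "{1..n} - {i}"] by auto
  qed
  then show ?thesis using i by (auto simp: dictatorship_def)
qed

end

section \<open>A non-dictatorial rule from a unique second\<close>

section \<open>Unique seconds\<close>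

context preference_domain
begin

text \<open>Voter 1 dictates, except that peak \<open>x\<close> lets voter 2 choose between \<open>x\<close> and its only
  second \<open>y\<close>.\<close>

lemma unique_seconds_rule:
  assumes y: "seconds A D x = {y}"
  defines "f \<equiv> \<lambda>p :: nat \<Rightarrow> 'a rel. if peak A (p 1) \<noteq> x then peak A (p 1) else if (x, y) \<in> p 2 then x else y"
  shows "rule A D 2 f" "strategy_proof D 2 f"
proof -
  have xy: "x \<in> A" "y \<in> A" "x \<noteq> y" using y by (auto elim: secondsE[of y])
  have N: "{1..2} = {1, 2 :: nat}" by auto
  have prof: "p 1 \<in> D \<and> p 2 \<in> D" if "p \<in> profiles 2 D" for p
    using that by (auto simp: profiles_def N)
  show "rule A D 2 f"
    unfolding rule_def
  proof
    show "scf A D 2 f"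
      using prof peak_in xy by (auto simp: scf_def f_def)
    show "unanimous A D 2 f"
      unfolding unanimous_def
    proof (intro ballI impI)
      fix p a assume p: "p \<in> profiles 2 D" and "\<forall>i\<in>{1..2}. peak A (p i) = a"
      then have "peak A (p 1) = a" "peak A (p 2) = a" by auto
      moreover have "p 2 \<in> D" using prof[OF p] by simp
      ultimately show "f p = a"
        using peak_preferred[of "p 2" y] xy by (auto simp: f_def)
    qed
  qed
  show "strategy_proof D 2 f"
    unfolding strategy_proof_def N
  proof (intro ballI)
    fix i p P' assume i: "i \<in> {1, 2 :: nat}" and p: "p \<in> profiles 2 D" and P': "P' \<in> D"
    have D: "p 1 \<in> D" "p 2 \<in> D" using prof[OF p] by auto
    have outcome_in: "f (p(i := P')) \<in> A"
      using peak_in[OF P'] peak_in[OF D(1)] xy by (auto simp: f_def)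
    consider "i = 1" "peak A (p 1) \<noteq> x" | "i = 1" "peak A (p 1) = x" "f p = x"
      | "i = 1" "peak A (p 1) = x" "f p = y" "(x, y) \<notin> p 2" | "i = 2"
      using i by (cases "peak A (p 1) = x"; cases "(x, y) \<in> p 2") (auto simp: f_def)
    then show "f p = f (p(i := P')) \<or> (f p, f (p(i := P'))) \<in> p i"
    proof cases
      case 1
      then have "f p = peak A (p i)" by (simp add: f_def)
      then show ?thesis using peak_preferred[OF D(1) outcome_in] 1(1) by metis
    next
      case 2
      then have "f p = peak A (p i)" by simp
      then show ?thesis using peak_preferred[OF D(1) outcome_in] 2(1) by metis
    next
      case 3
      \<comment> \<open>Uniqueness of the second enters here: only \<open>x\<close> is better than
        \<open>y\<close> for voter 1, and no report of voter 1 yields \<open>x\<close> while voter 2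
        does not prefer \<open>x\<close> to \<open>y\<close>.\<close>
      have "ranked A 2 (p 1) = y"
        using y 3 D by (auto simp: seconds_def peak_domain_def)
      moreover have "f (p(i := P')) \<noteq> x"
        using 3 xy by (auto simp: f_def)
      ultimately show ?thesis
        using second_preferred[OF D(1) outcome_in] 3 by metis
    next
      case 4
      \<comment> \<open>Voter 2 matters only when the peak of voter 1 is \<open>x\<close>, and then
        receives the better of \<open>x\<close> and \<open>y\<close>.\<close>
      then show ?thesis
        using totalP[OF D(2), of x y] xy by (auto simp: f_def)
    qed
  qed
qed

lemma unique_seconds_non_dictatorial:
  assumes conn: "path_connected_domain A D" and "unique_seconds A D"
  shows "non_dictatorial_domain A D"
proof -
  obtain x y where y: "seconds A D x = {y}"
    using assms(2) unfolding unique_seconds_def by (metis card_1_singletonE)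
  have xy: "x \<in> A" "y \<in> A" "x \<noteq> y" using y by (auto elim: secondsE[of y])
  obtain P where P: "P \<in> D" "peak A P = x"
    using exists_peak[OF conn xy(1)] peak_domainD by blast
  obtain Q where Q: "Q \<in> D" "peak A Q = y"
    using exists_peak[OF conn xy(2)] peak_domainD by blast
  define f where
    "f = (\<lambda>p :: nat \<Rightarrow> 'a rel. if peak A (p 1) \<noteq> x then peak A (p 1) else if (x, y) \<in> p 2 then x else y)"
  have N: "{1..2} = {1, 2 :: nat}" by auto
  have "(x, y) \<notin> Q"
    using peak_preferred[OF Q(1), of x] asymP[OF Q(1)] Q xy by auto
  \<comment> \<open>With peaks \<open>x\<close> and \<open>y\<close>, in either order, the outcome
    is \<open>y\<close>: the first profile rules out voter 1 as dictator, the second voter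
    2.\<close>
  then have "f (duo 2 {1} P Q) = y" "f (duo 2 {1} Q P) = y"
    using P Q xy by (auto simp: f_def duo_def)
  then have "f (duo 2 {1} P Q) \<noteq> peak A (duo 2 {1} P Q 1)"
    "f (duo 2 {1} Q P) \<noteq> peak A (duo 2 {1} Q P 2)"
    using P Q xy by (auto simp: duo_def)
  then have "\<not> dictatorship A D 2 f"
    using duo_profile[OF P(1) Q(1)] duo_profile[OF Q(1) P(1)] unfolding dictatorship_def N by blast
  then show ?thesis
    using unique_seconds_rule[OF y] unfolding non_dictatorial_domain_def dictatorial_domain_def f_def
    by blast
qed

end

theorem mainTheorem1:
  fixes A :: "'a set" and D :: "'a rel set"
  assumes "finite A" and "card A \<ge> 3"
    and "is_domain A D"
    and "path_connected_domain A D"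
    and "leaf_symmetry A D"
  shows "non_dictatorial_domain A D \<longleftrightarrow> unique_seconds A D"
proof -
  interpret preference_domain A D using assms(1-3) by unfold_locales
  have "dictatorial_domain A D" if "\<not> unique_seconds A D"
    unfolding dictatorial_domain_def
  proof (intro allI impI)
    fix n f assume "(2 :: nat) \<le> n" "rule A D n f \<and> strategy_proof D n f"
    then interpret non_unique_n_voter_rule A D n f
      using assms that by unfold_locales auto
    show "dictatorship A D n f" by (rule dictatorial)
  qed
  then show ?thesis
    using unique_seconds_non_dictatorial[OF assms(4)] by (auto simp: non_dictatorial_domain_def)
qed

end
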